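(* Let $k\ge1$ and let $\mathcal{M}$ be a gridding matrix such that (1) $\mathcal{M}$ has no completely empty rows or columns; (2) every row and every column of $\mathcal{M}$ contains at most two non-empty cells; and (3) the graph $G_\mathcal{M}$ is a path of length $k$ (with $k$ edges) whose internal vertices are each labelled by $\mathrm{Av}(21)$ or $\mathrm{Av}(12)$ and whose two end vertices are each labelled by either $\oplus21$ or $\ominus12$. Then $\mathcal{M}$ and $\mathcal{M}^k$ are equivalent under some grid mapping.
   Context: Matrices are indexed from the bottom-left with column index first: an $m\times n$ matrix has $m$ columns and $n$ rows, $\mathcal{M}_{ij}$ in column $i$, row $j$. A gridding matrix has entries that are permutation classes (infinite or empty, $\varnothing$). $\mathrm{Av}(21)$, $\mathrm{Av}(12)$ are the increasing and decreasing permutations. $\oplus21$ is the class of all direct sums $\alpha_1\oplus\cdots\oplus\alpha_r$ with each $\alpha_i\le21$, and $\ominus12$ the class of all skew sums $\alpha_1\ominus\cdots\ominus\alpha_r$ with each $\alpha_i\le12$. $G_\mathcal{M}$ is the graph on the non-empty cells in which two cells are adjacent if they share a row or column and all cells strictly between them are empty. Grid mappings: grid inverse $\phi$ with $(\phi(\mathcal{M}))_{ij}=(\mathcal{M}_{ji})^{-1}$ (classes of inverses); $i$th column reverse replacing each entry in column $i$ by its reverse class; $j$th row complement replacing each entry in row $j$ by its complement class; column permutation $\mu$: $(\mu(\mathcal{M}))_{ij}=\mathcal{M}_{\mu(i)j}$; row permutation $\nu$: $(\nu(\mathcal{M}))_{ij}=\mathcal{M}_{i\nu(j)}$; a grid mapping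 is any composition of these. $\mathcal{M}$ and $\mathcal{N}$ are equivalent under a grid mapping if $f(\mathcal{M})=\mathcal{N}$ for some grid mapping $f$. The matrices $\mathcal{M}^k$: let $\mathcal{C}=\mathcal{D}^+=\oplus21$ and $\mathcal{D}^-=\ominus12$. $\mathcal{M}^1$ is the $2\times1$ matrix with $\mathcal{M}^1_{11}=\mathcal{C}$, $\mathcal{M}^1_{21}=\mathcal{D}^-$. For $k\ge2$, with $\ell\ge0$: if $k=4\ell+1$, $\mathcal{M}^k$ is $(2\ell+2)\times(2\ell+1)$ with $\mathcal{M}^k_{ij}=\mathcal{M}^{k-1}_{ij}$ for $i\in[1,2\ell+1],j\in[2,2\ell+1]$, $\mathcal{M}^k_{(2\ell+2)1}=\mathcal{D}^-$, $\mathcal{M}^k_{11}=\mathrm{Av}(21)$, all other entries $\varnothing$; if $k=4\ell+2$, $\mathcal{M}^k$ is $(2\ell+2)\times(2\ell+2)$ with $\mathcal{M}^k_{ij}=\mathcal{M}^{k-1}_{ij}$ for $i,j\in[1,2\ell+1]$, $\mathcal{M}^k_{(2\ell+2)(2\ell+2)}=\mathcal{D}^+$, $\mathcal{M}^k_{(2\ell+2)1}=\mathrm{Av}(12)$, others $\varnothing$; if $k=4\ell+3$, $\mathcal{M}^k$ is $(2\ell+3)\times(2\ell+2)$ with $\mathcal{M}^k_{ij}=\mathcal{M}^{k-1}_{(i-1)j}$ for $i\in[2,2\ell+3],j\in[1,2\ell+1]$, $\mathcal{M}^k_{1(2\ell+2)}=\mathcal{D}^-$, $\mathcal{M}^k_{(2\ell+3)(2\ell+2)}=\mathrm{Av}(21)$,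 others $\varnothing$; if $k=4\ell+4$, $\mathcal{M}^k$ is $(2\ell+3)\times(2\ell+3)$ with $\mathcal{M}^k_{ij}=\mathcal{M}^{k-1}_{i(j-1)}$ for $i\in[1,2\ell+2],j\in[2,2\ell+3]$, $\mathcal{M}^k_{11}=\mathcal{D}^+$, $\mathcal{M}^k_{1(2\ell+3)}=\mathrm{Av}(12)$, others $\varnothing$.
   Formalization: In the definition of M^k for k=4ℓ+4, the range i∈[1,2ℓ+2] is corrected to i∈[2,2ℓ+3]; as printed, cell (1,2ℓ+3) is assigned both D^- and Av(12), and column 2ℓ+3 would be empty, making the claim fail. *)

theory Defs
  imports Main "HOL-Library.Sublist" "HOL-Combinatorics.Permutations"
begin

text \<open>Permutations of \<open>{1..n}\<close> are lists in one-line notation; the empty permutation is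
  allowed, so every non-empty permutation class contains it.\<close>

type_synonym oneline = "nat list"

definition is_perm :: "oneline \<Rightarrow> bool" where
  "is_perm \<pi> \<longleftrightarrow> distinct \<pi> \<and> set \<pi> = {1..length \<pi>}"

definition order_iso :: "nat list \<Rightarrow> nat list \<Rightarrow> bool" where
  "order_iso xs ys \<longleftrightarrow> length xs = length ys \<and>
     (\<forall>a<length xs. \<forall>b<length xs. xs ! a < xs ! b \<longleftrightarrow> ys ! a < ys ! b)"

definition contained_in :: "oneline \<Rightarrow> oneline \<Rightarrow> bool" (infix "\<preceq>" 50) where
  "\<sigma> \<preceq> \<pi> \<longleftrightarrow> (\<exists>xs. subseq xs \<pi> \<and> order_iso xs \<sigma>)"

definition perm_class :: "oneline set \<Rightarrow> bool" where
  "perm_class C \<longleftrightarrow> (\<forall>\<pi>\<in>C. is_perm \<pi>) \<and> (\<forall>\<pi>\<in>C. \<forall>\<sigma>. is_perm \<sigma> \<and> \<sigma> \<preceq> \<pi> \<longrightarrow> \<sigma> \<in> C)"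

definition Av :: "oneline \<Rightarrow> oneline set" where
  "Av \<beta> = {\<pi>. is_perm \<pi> \<and> \<not> \<beta> \<preceq> \<pi>}"

definition direct_sum :: "oneline \<Rightarrow> oneline \<Rightarrow> oneline" where
  "direct_sum \<alpha> \<beta> = \<alpha> @ map (\<lambda>v. v + length \<alpha>) \<beta>"

definition skew_sum :: "oneline \<Rightarrow> oneline \<Rightarrow> oneline" where
  "skew_sum \<alpha> \<beta> = map (\<lambda>v. v + length \<beta>) \<alpha> @ \<beta>"

definition direct_sums_of :: "oneline \<Rightarrow> oneline set" where
  "direct_sums_of \<beta> = {foldr direct_sum \<alpha>s [] |\<alpha>s. \<forall>\<alpha>\<in>set \<alpha>s. is_perm \<alpha> \<and> \<alpha> \<preceq> \<beta>}"

definition skew_sums_of :: "oneline \<Rightarrow> oneline set" where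
  "skew_sums_of \<beta> = {foldr skew_sum \<alpha>s [] |\<alpha>s. \<forall>\<alpha>\<in>set \<alpha>s. is_perm \<alpha> \<and> \<alpha> \<preceq> \<beta>}"

abbreviation oplus21 :: "oneline set" where
  "oplus21 \<equiv> direct_sums_of [2, 1]"

abbreviation ominus12 :: "oneline set" where
  "ominus12 \<equiv> skew_sums_of [1, 2]"

definition perm_inverse :: "oneline \<Rightarrow> oneline" where
  "perm_inverse \<pi> = map (\<lambda>v. Suc (length (takeWhile (\<lambda>x. x \<noteq> v) \<pi>))) [1..<Suc (length \<pi>)]"

definition perm_complement :: "oneline \<Rightarrow> oneline" where
  "perm_complement \<pi> = map (\<lambda>v. Suc (length \<pi>) - v) \<pi>"

text \<open>In \<open>entry M i j\<close> the first index is the column (counted from the left) and the second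
  the row (counted from the bottom), both starting at 1.  Entries outside the matrix are required to be
  empty in \<open>gridding_matrix\<close>, so that equality of records is equality of matrices.\<close>

record gmatrix =
  ncols :: nat
  nrows :: nat
  entry :: "nat \<Rightarrow> nat \<Rightarrow> oneline set"

definition gridding_matrix :: "gmatrix \<Rightarrow> bool" where
  "gridding_matrix M \<longleftrightarrow>
     (\<forall>i j. entry M i j = {} \<or> perm_class (entry M i j) \<and> infinite (entry M i j)) \<and>
     (\<forall>i j. i \<notin> {1..ncols M} \<or> j \<notin> {1..nrows M} \<longrightarrow> entry M i j = {})"

definition no_empty_line :: "gmatrix \<Rightarrow> bool" where
  "no_empty_line M \<longleftrightarrow>
     (\<forall>i\<in>{1..ncols M}. \<exists>j\<in>{1..nrows M}. entry M i j \<noteq> {}) \<and>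
     (\<forall>j\<in>{1..nrows M}. \<exists>i\<in>{1..ncols M}. entry M i j \<noteq> {})"

definition at_most_two_per_line :: "gmatrix \<Rightarrow> bool" where
  "at_most_two_per_line M \<longleftrightarrow>
     (\<forall>i\<in>{1..ncols M}. card {j \<in> {1..nrows M}. entry M i j \<noteq> {}} \<le> 2) \<and>
     (\<forall>j\<in>{1..nrows M}. card {i \<in> {1..ncols M}. entry M i j \<noteq> {}} \<le> 2)"

definition cells :: "gmatrix \<Rightarrow> (nat \<times> nat) set" where
  "cells M = {(i, j). i \<in> {1..ncols M} \<and> j \<in> {1..nrows M} \<and> entry M i j \<noteq> {}}"

definition cell_adj :: "gmatrix \<Rightarrow> nat \<times> nat \<Rightarrow> nat \<times> nat \<Rightarrow> bool" where
  "cell_adj M = (\<lambda>(i, j) (i', j').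
     (i, j) \<in> cells M \<and> (i', j') \<in> cells M \<and> (i, j) \<noteq> (i', j') \<and>
     (i = i' \<and> (\<forall>r. min j j' < r \<and> r < max j j' \<longrightarrow> entry M i r = {}) \<or>
      j = j' \<and> (\<forall>c. min i i' < c \<and> c < max i i' \<longrightarrow> entry M c j = {})))"

text \<open>The graph with vertex set \<open>V\<close> and adjacency \<open>E\<close> is a path with \<open>k\<close> edges,
  and \<open>vs\<close> lists its vertices in path order.\<close>

definition path_graph_listing :: "'v set \<Rightarrow> ('v \<Rightarrow> 'v \<Rightarrow> bool) \<Rightarrow> nat \<Rightarrow> 'v list \<Rightarrow> bool" where
  "path_graph_listing V E k vs \<longleftrightarrow>
     length vs = Suc k \<and> distinct vs \<and> set vs = V \<and>
     (\<forall>a\<le>k. \<forall>b\<le>k. E (vs ! a) (vs ! b) \<longleftrightarrow> b = Suc a \<or> a = Suc b)"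

definition grid_inverse :: "gmatrix \<Rightarrow> gmatrix" where
  "grid_inverse M = \<lparr>ncols = nrows M, nrows = ncols M,
     entry = (\<lambda>i j. perm_inverse ` entry M j i)\<rparr>"

definition column_reverse :: "nat \<Rightarrow> gmatrix \<Rightarrow> gmatrix" where
  "column_reverse c M =
     M\<lparr>entry := (\<lambda>i j. if i = c then rev ` entry M i j else entry M i j)\<rparr>"

definition row_complement :: "nat \<Rightarrow> gmatrix \<Rightarrow> gmatrix" where
  "row_complement r M =
     M\<lparr>entry := (\<lambda>i j. if j = r then perm_complement ` entry M i j else entry M i j)\<rparr>"

definition column_permutation :: "(nat \<Rightarrow> nat) \<Rightarrow> gmatrix \<Rightarrow> gmatrix" where
  "column_permutation \<mu> M = M\<lparr>entry := (\<lambda>i j. entry M (\<mu> i) j)\<rparr>"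

definition row_permutation :: "(nat \<Rightarrow> nat) \<Rightarrow> gmatrix \<Rightarrow> gmatrix" where
  "row_permutation \<nu> M = M\<lparr>entry := (\<lambda>i j. entry M i (\<nu> j))\<rparr>"

text \<open>\<open>grid_mapping (m, n) (m', n') f\<close>: \<open>f\<close> is a grid mapping from matrices with \<open>m\<close> columns and
  \<open>n\<close> rows to matrices with \<open>m'\<close> columns and \<open>n'\<close> rows.  Tracking the dimensions ensures that only
  permutations of the actual index sets are used.\<close>

inductive grid_mapping :: "nat \<times> nat \<Rightarrow> nat \<times> nat \<Rightarrow> (gmatrix \<Rightarrow> gmatrix) \<Rightarrow> bool" where
  inverse: "grid_mapping (m, n) (n, m) grid_inverse"
| column_reverse: "c \<in> {1..m} \<Longrightarrow> grid_mapping (m, n) (m, n) (column_reverse c)"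
| row_complement: "r \<in> {1..n} \<Longrightarrow> grid_mapping (m, n) (m, n) (row_complement r)"
| column_permutation: "\<mu> permutes {1..m} \<Longrightarrow> grid_mapping (m, n) (m, n) (column_permutation \<mu>)"
| row_permutation: "\<nu> permutes {1..n} \<Longrightarrow> grid_mapping (m, n) (m, n) (row_permutation \<nu>)"
| comp: "grid_mapping d d' f \<Longrightarrow> grid_mapping d' d'' g \<Longrightarrow> grid_mapping d d'' (g \<circ> f)"

definition grid_equivalent :: "gmatrix \<Rightarrow> gmatrix \<Rightarrow> bool" where
  "grid_equivalent M N \<longleftrightarrow>
     (\<exists>f. grid_mapping (ncols M, nrows M) (ncols N, nrows N) f \<and> f M = N)"

text \<open>\<open>path_matrix k\<close> is the matrix usually written \<open>\<M>\<^sup>k\<close>, for \<open>k \<ge> 1\<close>; the value at 0 is a dummy.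
  With \<open>l = k div 4\<close>, the index \<open>Suc k\<close> is \<open>4l+1\<close>, \<open>4l+2\<close>, \<open>4l+3\<close> or \<open>4l+4\<close> according to
  \<open>k mod 4\<close>.  In the last case the old matrix occupies columns \<open>2..2l+3\<close>: its first
  column has a single non-empty entry, which is the one overwritten by \<open>Av [1, 2]\<close>; starting the range
  at column 1 and stopping at \<open>2l+2\<close> instead would lose the last column of the old matrix.\<close>

primrec path_matrix :: "nat \<Rightarrow> gmatrix" where
  "path_matrix 0 = \<lparr>ncols = 0, nrows = 0, entry = (\<lambda>i j. {})\<rparr>"
| "path_matrix (Suc k) =
    (let l = k div 4; P = entry (path_matrix k) in
     if k = 0 then
       \<lparr>ncols = 2, nrows = 1, entry = (\<lambda>i j.
          if (i, j) = (1, 1) then oplus21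
          else if (i, j) = (2, 1) then ominus12
          else {})\<rparr>
     else if k mod 4 = 0 then
       \<lparr>ncols = 2*l+2, nrows = 2*l+1, entry = (\<lambda>i j.
          if i \<in> {1..2*l+1} \<and> j \<in> {2..2*l+1} then P i j
          else if (i, j) = (2*l+2, 1) then ominus12
          else if (i, j) = (1, 1) then Av [2, 1]
          else {})\<rparr>
     else if k mod 4 = 1 then
       \<lparr>ncols = 2*l+2, nrows = 2*l+2, entry = (\<lambda>i j.
          if i \<in> {1..2*l+1} \<and> j \<in> {1..2*l+1} then P i j
          else if (i, j) = (2*l+2, 2*l+2) then oplus21
          else if (i, j) = (2*l+2, 1) then Av [1, 2]
          else {})\<rparr>
     else if k mod 4 = 2 then
       \<lparr>ncols = 2*l+3, nrows = 2*l+2, entry = (\<lambda>i j.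
          if i \<in> {2..2*l+3} \<and> j \<in> {1..2*l+1} then P (i - 1) j
          else if (i, j) = (1, 2*l+2) then ominus12
          else if (i, j) = (2*l+3, 2*l+2) then Av [2, 1]
          else {})\<rparr>
     else
       \<lparr>ncols = 2*l+3, nrows = 2*l+3, entry = (\<lambda>i j.
          if i \<in> {2..2*l+3} \<and> j \<in> {2..2*l+3} then P i (j - 1)
          else if (i, j) = (1, 1) then oplus21
          else if (i, j) = (1, 2*l+3) then Av [1, 2]
          else {})\<rparr>)"

end

theory Submission
  imports Defs
begin

text \<open>A path of cells turns at every internal vertex, because three cells never share a line. Hence,
  up to a grid inverse, its edges are alternately horizontal and vertical starting with a horizontal
  one, and the \<open>a\<close>-th cell lies in the \<open>(a + 1) div 2\<close>-th column and the \<open>a div 2\<close>-th row that the path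
  meets (all counted from 0). Permuting lines makes the positions of two such matrices of the same length agree. The lines
  themselves, in the order in which they are met, form a path whose edges are the cells; flipping
  a line swaps the increasing and decreasing type of its cells, so going along this path all the types
  can be corrected one after the other.\<close>

section \<open>Symmetries of the four labels\<close>

text \<open>Each of the four label classes is closed under inverses, while reversal and complement
  both exchange \<open>oplus21\<close> with \<open>ominus12\<close> and \<open>Av [2, 1]\<close>
  with \<open>Av [1, 2]\<close>. So besides the positions of its cells the matrix carries one
  Boolean per cell. No condition on these Booleans arises because the lines form a path and not a
  cycle: each new line is free to correct the one cell that joins it to its predecessor. The target
  \<open>path_matrix k\<close> has to be recognised as such a matrix too. Its recursion adds a line
  at the right, top, left and bottom in turn, so the path spirals outwards; each step makes the old
  end cell monotone and appends a new end. The induction therefore has to know the corner in which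
  the path currently ends, and has to renumber the old lines when the new one comes at the left or
  at the bottom.\<close>

lemma sorted_wrt_iff_subseq_pairs:
  "sorted_wrt R xs \<longleftrightarrow> (\<forall>x y. subseq [x, y] xs \<longrightarrow> R x y)"
proof (induction xs)
  case Nil
  show ?case by simp
next
  case (Cons a xs)
  have "subseq [x, y] (a # xs) \<longleftrightarrow> (x = a \<and> y \<in> set xs) \<or> subseq [x, y] xs" for x y
    using subseq_Cons'[of x "[y]" xs] by (auto simp: subseq_singleton_left)
  with Cons show ?case by auto
qed

lemma order_iso_pair_iff:
  "order_iso xs [u, v] \<longleftrightarrow> (\<exists>x y. xs = [x, y] \<and> (x < y \<longleftrightarrow> u < v) \<and> (y < x \<longleftrightarrow> v < u))"
proof
  assume iso: "order_iso xs [u, v]"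
  then obtain x y where "xs = [x, y]"
    by (auto simp: order_iso_def length_Suc_conv)
  with iso show "\<exists>x y. xs = [x, y] \<and> (x < y \<longleftrightarrow> u < v) \<and> (y < x \<longleftrightarrow> v < u)"
    by (auto simp: order_iso_def All_less_Suc2 numeral_2_eq_2)
qed (auto simp: order_iso_def less_Suc_eq numeral_2_eq_2)

lemma perm_eq_iota_iff: "is_perm \<pi> \<and> sorted \<pi> \<longleftrightarrow> \<pi> \<in> range (\<lambda>n. [1..<Suc n])"
proof
  assume \<pi>: "is_perm \<pi> \<and> sorted \<pi>"
  then have "\<pi> = [1..<Suc (length \<pi>)]"
    by (intro sorted_distinct_set_unique)
      (auto simp: is_perm_def atLeastLessThanSuc_atLeastAtMost simp del: upt_Suc)
  then show "\<pi> \<in> range (\<lambda>n. [1..<Suc n])"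
    by blast
qed (auto simp: is_perm_def simp del: upt_Suc)

lemma is_perm_rev [simp]: "is_perm (rev \<pi>) \<longleftrightarrow> is_perm \<pi>"
  by (simp add: is_perm_def)

lemma Av_21_eq: "Av [2, 1] = range (\<lambda>n. [1..<Suc n])"
proof -
  have "[2, 1] \<preceq> \<pi> \<longleftrightarrow> \<not> sorted \<pi>" for \<pi>
    unfolding contained_in_def order_iso_pair_iff sorted_wrt_iff_subseq_pairs
    by (force simp: not_le)
  then show ?thesis
    by (auto simp: Av_def perm_eq_iota_iff simp del: upt_Suc)
qed

lemma Av_12_eq: "Av [1, 2] = rev ` Av [2, 1]"
proof -
  have "[1, 2] \<preceq> \<pi> \<longleftrightarrow> \<not> sorted_wrt (\<ge>) \<pi>" for \<pi>
    unfolding contained_in_def order_iso_pair_iff sorted_wrt_iff_subseq_pairs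
    by (force simp: not_le)
  then have "\<pi> \<in> Av [1, 2] \<longleftrightarrow> is_perm (rev \<pi>) \<and> sorted (rev \<pi>)" for \<pi>
    by (simp add: Av_def sorted_wrt_rev)
  then have "\<pi> \<in> Av [1, 2] \<longleftrightarrow> rev \<pi> \<in> Av [2, 1]" for \<pi>
    unfolding Av_21_eq perm_eq_iota_iff[symmetric] by simp
  then have *: "Av [1, 2] = {\<pi>. rev \<pi> \<in> Av [2, 1]}"
    by blast
  have "{xs. rev xs \<in> A} = rev ` A" for A :: "nat list set"
    by (force simp: image_iff)
  with * show ?thesis
    by simp
qed

lemma is_perm_two_cases:
  assumes "is_perm \<alpha>" and "length \<alpha> \<le> 2"
  shows "\<alpha> \<in> {[], [1], [1, 2], [2, 1]}"
proof -
  consider "\<alpha> = []" | x where "\<alpha> = [x]" | x y where "\<alpha> = [x, y]"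
    using assms(2) by (cases \<alpha> rule: remdups_adj.cases) auto
  then show ?thesis
  proof cases
    case (3 x y)
    have "{1..2} = {1, 2::nat}"
      by auto
    with 3 assms(1) have "{x, y} = {1, 2}"
      by (simp add: is_perm_def numeral_2_eq_2)
    with 3 show ?thesis
      by (auto simp: doubleton_eq_iff)
  qed (use assms(1) in \<open>auto simp: is_perm_def\<close>)
qed

text \<open>A sublist of full length two must be \<open>\<beta>\<close> itself, and below length two
  there is one permutation of each length. This replaces containment by a finite alphabet of blocks,
  so that the label classes can be handled by induction over lists of blocks.\<close>

lemma perm_contained_in_pair_iff:
  assumes "\<beta> = [2, 1] \<or> \<beta> = [1, 2]"
  shows "is_perm \<alpha> \<and> \<alpha> \<preceq> \<beta> \<longleftrightarrow> \<alpha> \<in> {[], [1], \<beta>}"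
proof
  assume \<alpha>: "is_perm \<alpha> \<and> \<alpha> \<preceq> \<beta>"
  then obtain xs where xs: "subseq xs \<beta>" "order_iso xs \<alpha>"
    unfolding contained_in_def by blast
  then have len: "length xs = length \<alpha>" "length xs \<le> 2"
    using assms list_emb_length[OF xs(1)] by (auto simp: order_iso_def)
  show "\<alpha> \<in> {[], [1], \<beta>}"
  proof (cases "length xs = 2")
    case True
    then have "xs = \<beta>"
      using xs(1) assms by (intro subseq_same_length) auto
    with xs(2) show ?thesis
      using is_perm_two_cases[of \<alpha>] \<alpha> len assms
      by (auto simp: order_iso_pair_iff)
  next
    case False
    then show ?thesis
      using is_perm_two_cases[of \<alpha>] \<alpha> len by force
  qed
next
  assume "\<alpha> \<in> {[], [1], \<beta>}"
  moreover have "[] \<preceq> \<beta>" "\<beta> \<preceq> \<beta>"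
    by (auto simp: contained_in_def order_iso_def)
  moreover have "[1] \<preceq> \<beta>"
    using assms by (auto simp: contained_in_def order_iso_def intro!: exI[of _ "[1]"])
  ultimately show "is_perm \<alpha> \<and> \<alpha> \<preceq> \<beta>"
    using assms by (auto simp: is_perm_def)
qed

lemma oplus21_eq: "oplus21 = {foldr direct_sum \<alpha>s [] |\<alpha>s. set \<alpha>s \<subseteq> {[], [1], [2, 1]}}"
  unfolding direct_sums_of_def using perm_contained_in_pair_iff[of "[2, 1]"] by auto

lemma ominus12_eq: "ominus12 = {foldr skew_sum \<alpha>s [] |\<alpha>s. set \<alpha>s \<subseteq> {[], [1], [1, 2]}}"
  unfolding skew_sums_of_def using perm_contained_in_pair_iff[of "[1, 2]"] by auto

section \<open>Complement, inverse and reverse on direct and skew sums\<close>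

lemma perm_complement_nth: "i < length \<pi> \<Longrightarrow> perm_complement \<pi> ! i = Suc (length \<pi>) - \<pi> ! i"
  by (simp add: perm_complement_def)

lemma length_perm_complement [simp]: "length (perm_complement \<pi>) = length \<pi>"
  by (simp add: perm_complement_def)

lemma length_perm_inverse [simp]: "length (perm_inverse \<pi>) = length \<pi>"
  by (simp add: perm_inverse_def del: upt_Suc)

lemma perm_complement_perm_complement:
  "perm_complement (perm_complement \<pi>) = \<pi>" if "is_perm \<pi>"
proof -
  \<comment> \<open>Subtraction on naturals truncates, so the involution depends on all values being
    at most \<open>length \<pi>\<close>.\<close>
  have "Suc (length \<pi>) - (Suc (length \<pi>) - \<pi> ! i) = \<pi> ! i" if "i < length \<pi>" for i
    using nth_mem[OF that] \<open>is_perm \<pi>\<close> by (auto simp: is_perm_def)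
  then show ?thesis
    by (intro nth_equalityI) (auto simp: perm_complement_nth)
qed

text \<open>The value \<open>v\<close> stands in the complement where \<open>Suc n - v\<close>
  stands in \<open>\<pi>\<close>, so listing positions by increasing value runs through the old list
  backwards.\<close>

lemma perm_inverse_perm_complement:
  "perm_inverse (perm_complement \<pi>) = rev (perm_inverse \<pi>)" if "is_perm \<pi>"
proof -
  define n where "n = length \<pi>"
  have le: "x \<le> n" if "x \<in> set \<pi>" for x
    using that \<open>is_perm \<pi>\<close> by (auto simp: is_perm_def n_def)
  have "takeWhile (\<lambda>x. x \<noteq> v) (perm_complement \<pi>)
      = map (\<lambda>v. Suc n - v) (takeWhile (\<lambda>x. x \<noteq> Suc n - v) \<pi>)" if "v \<in> {1..n}" for v
    unfolding perm_complement_def takeWhile_map n_def[symmetric]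
    using that le by (intro arg_cong[where f="map _"] takeWhile_cong) (force simp: o_def)+
  then show ?thesis
    unfolding perm_inverse_def length_perm_complement n_def[symmetric]
    by (intro nth_equalityI) (auto simp: nth_append rev_nth Suc_diff_Suc simp del: upt_Suc)
qed

lemma direct_sum_Nil [simp]: "direct_sum [] \<beta> = \<beta>" "direct_sum \<beta> [] = \<beta>"
  by (simp_all add: direct_sum_def)

lemma skew_sum_Nil [simp]: "skew_sum [] \<beta> = \<beta>" "skew_sum \<beta> [] = \<beta>"
  by (simp_all add: skew_sum_def)

lemma skew_sum_assoc: "skew_sum (skew_sum \<alpha> \<beta>) \<gamma> = skew_sum \<alpha> (skew_sum \<beta> \<gamma>)"
  by (simp add: skew_sum_def algebra_simps)

text \<open>Reversing a direct sum puts the first block last; this rule splits off a block that has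
  moved to the end of the fold.\<close>

lemma foldr_skew_sum: "foldr skew_sum \<alpha>s \<beta> = skew_sum (foldr skew_sum \<alpha>s []) \<beta>"
  by (induction \<alpha>s) (simp_all add: skew_sum_assoc)

lemma rev_direct_sum: "rev (direct_sum \<alpha> \<beta>) = skew_sum (rev \<beta>) (rev \<alpha>)"
  by (simp add: direct_sum_def skew_sum_def rev_map)

lemma is_perm_direct_sum: "is_perm \<alpha> \<Longrightarrow> is_perm \<beta> \<Longrightarrow> is_perm (direct_sum \<alpha> \<beta>)"
proof -
  assume *: "is_perm \<alpha>" "is_perm \<beta>"
  have "(\<lambda>v. v + length \<alpha>) ` {1..length \<beta>} = {Suc (length \<alpha>)..length \<alpha> + length \<beta>}"
    by (simp add: add.commute)
  with * show ?thesis
    by (auto simp: is_perm_def direct_sum_def distinct_map inj_on_def)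
qed

lemma perm_complement_direct_sum:
  "perm_complement (direct_sum \<alpha> \<beta>) = skew_sum (perm_complement \<alpha>) (perm_complement \<beta>)"
  if "is_perm \<alpha>"
  using that by (auto simp: perm_complement_def direct_sum_def skew_sum_def is_perm_def)

text \<open>The search for a value at most \<open>length \<alpha>\<close> ends inside
  \<open>\<alpha>\<close>; for a larger value it passes over all of \<open>\<alpha>\<close> and
  continues in the shifted \<open>\<beta>\<close>.\<close>

lemma perm_inverse_direct_sum:
  "perm_inverse (direct_sum \<alpha> \<beta>) = direct_sum (perm_inverse \<alpha>) (perm_inverse \<beta>)"
  if "is_perm \<alpha>"
proof (rule nth_equalityI)
  fix i assume "i < length (perm_inverse (direct_sum \<alpha> \<beta>))"
  then have i: "i < length \<alpha> + length \<beta>"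
    by (simp add: direct_sum_def)
  have \<alpha>: "set \<alpha> = {1..length \<alpha>}"
    using that by (simp add: is_perm_def)
  show "perm_inverse (direct_sum \<alpha> \<beta>) ! i = direct_sum (perm_inverse \<alpha>) (perm_inverse \<beta>) ! i"
  proof (cases "i < length \<alpha>")
    case True
    then have "Suc i \<in> set \<alpha>"
      using \<alpha> by simp
    then have "takeWhile (\<lambda>x. x \<noteq> Suc i) (direct_sum \<alpha> \<beta>) = takeWhile (\<lambda>x. x \<noteq> Suc i) \<alpha>"
      unfolding direct_sum_def by (rule takeWhile_append1) simp
    with True i show ?thesis
      by (simp add: perm_inverse_def direct_sum_def nth_append del: upt_Suc)
  next
    case False
    have "takeWhile (\<lambda>x. x \<noteq> Suc i) (direct_sum \<alpha> \<beta>)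
        = \<alpha> @ takeWhile (\<lambda>x. x \<noteq> Suc i) (map (\<lambda>v. v + length \<alpha>) \<beta>)"
      unfolding direct_sum_def using \<alpha> False by (intro takeWhile_append2) auto
    also have "takeWhile (\<lambda>x. x \<noteq> Suc i) (map (\<lambda>v. v + length \<alpha>) \<beta>)
        = map (\<lambda>v. v + length \<alpha>) (takeWhile (\<lambda>x. x \<noteq> Suc (i - length \<alpha>)) \<beta>)"
      unfolding takeWhile_map using False
      by (intro arg_cong[where f="map _"] takeWhile_cong) auto
    finally show ?thesis
      using False i
      by (simp add: perm_inverse_def direct_sum_def nth_append del: upt_Suc)
  qed
qed (simp add: direct_sum_def)

lemma is_perm_in_oplus21: "\<pi> \<in> oplus21 \<Longrightarrow> is_perm \<pi>"
proof -
  have "is_perm (foldr direct_sum \<alpha>s [])" if "\<forall>\<alpha>\<in>set \<alpha>s. is_perm \<alpha>" for \<alpha>s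
    using that by (induction \<alpha>s) (auto simp: is_perm_direct_sum is_perm_def[of "[]"])
  then show "\<pi> \<in> oplus21 \<Longrightarrow> is_perm \<pi>"
    by (auto simp: direct_sums_of_def)
qed

text \<open>Inversion acts on a direct sum block by block and fixes each admissible block.\<close>

lemma perm_inverse_in_oplus21: "\<pi> \<in> oplus21 \<Longrightarrow> perm_inverse \<pi> = \<pi>"
proof -
  have *: "perm_inverse [] = []" "perm_inverse [1] = [1]" "perm_inverse [2, 1] = [2, 1]"
    by (simp_all add: perm_inverse_def numeral_2_eq_2)
  have "perm_inverse (foldr direct_sum \<alpha>s []) = foldr direct_sum \<alpha>s []"
    if "set \<alpha>s \<subseteq> {[], [1], [2, 1]}" for \<alpha>s
    using that
  proof (induction \<alpha>s)
    case (Cons \<alpha> \<alpha>s)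
    then have "is_perm \<alpha>" "perm_inverse \<alpha> = \<alpha>"
      using * by (auto simp: is_perm_def)
    with Cons show ?case
      by (simp add: perm_inverse_direct_sum)
  qed (simp add: *)
  then show "\<pi> \<in> oplus21 \<Longrightarrow> perm_inverse \<pi> = \<pi>"
    unfolding oplus21_eq by blast
qed

text \<open>Reversal turns a direct sum into a skew sum with the blocks in opposite order and each
  block reversed, which sends 21 to 12.\<close>

lemma rev_oplus21: "rev ` oplus21 = ominus12"
proof -
  have fold: "rev (foldr direct_sum \<alpha>s []) = foldr skew_sum (rev (map rev \<alpha>s)) []" for \<alpha>s
  proof (induction \<alpha>s)
    case (Cons \<alpha> \<alpha>s)
    then show ?case
      by (simp add: rev_direct_sum foldr_skew_sum[of _ "rev \<alpha>"])
  qed simp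
  show ?thesis
  proof (intro equalityI subsetI)
    fix \<pi> assume "\<pi> \<in> rev ` oplus21"
    then obtain \<alpha>s where \<alpha>s: "set \<alpha>s \<subseteq> {[], [1], [2, 1]}" "\<pi> = rev (foldr direct_sum \<alpha>s [])"
      unfolding oplus21_eq by blast
    then have "set (rev (map rev \<alpha>s)) \<subseteq> {[], [1], [1, 2]}"
      by auto
    with \<alpha>s(2) show "\<pi> \<in> ominus12"
      unfolding fold ominus12_eq by blast
  next
    fix \<pi> assume "\<pi> \<in> ominus12"
    then obtain \<alpha>s where \<alpha>s: "set \<alpha>s \<subseteq> {[], [1], [1, 2]}" "\<pi> = foldr skew_sum \<alpha>s []"
      unfolding ominus12_eq by blast
    then have "set (rev (map rev \<alpha>s)) \<subseteq> {[], [1], [2, 1]}"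
      by auto
    moreover have "\<pi> = rev (foldr direct_sum (rev (map rev \<alpha>s)) [])"
      using \<alpha>s(2) by (simp add: fold rev_map)
    ultimately show "\<pi> \<in> rev ` oplus21"
      unfolding oplus21_eq by blast
  qed
qed

text \<open>Unlike reversal, complement keeps the order of the blocks and acts on each of
  them.\<close>

lemma perm_complement_oplus21: "perm_complement ` oplus21 = ominus12"
proof -
  have fold: "perm_complement (foldr direct_sum \<alpha>s []) = foldr skew_sum (map perm_complement \<alpha>s) []"
    if "\<forall>\<alpha>\<in>set \<alpha>s. is_perm \<alpha>" for \<alpha>s
    using that
    by (induction \<alpha>s) (simp_all add: perm_complement_direct_sum, simp add: perm_complement_def)
  have perm: "is_perm []" "is_perm [1]" "is_perm [2, 1]"
    by (auto simp: is_perm_def)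
  have compl: "perm_complement [] = []" "perm_complement [1] = [1]"
    "perm_complement [2, 1] = [1, 2]" "perm_complement [1, 2] = [2, 1]"
    by (simp_all add: perm_complement_def)
  show ?thesis
  proof (intro equalityI subsetI)
    fix \<pi> assume "\<pi> \<in> perm_complement ` oplus21"
    then obtain \<alpha>s where \<alpha>s: "set \<alpha>s \<subseteq> {[], [1], [2, 1]}"
        "\<pi> = perm_complement (foldr direct_sum \<alpha>s [])"
      unfolding oplus21_eq by blast
    then have "\<pi> = foldr skew_sum (map perm_complement \<alpha>s) []"
      using fold[of \<alpha>s] perm by auto
    moreover have "set (map perm_complement \<alpha>s) \<subseteq> {[], [1], [1, 2]}"
      using \<alpha>s(1) compl by auto
    ultimately show "\<pi> \<in> ominus12"
      unfolding ominus12_eq by blast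
  next
    fix \<pi> assume "\<pi> \<in> ominus12"
    then obtain \<alpha>s where \<alpha>s: "set \<alpha>s \<subseteq> {[], [1], [1, 2]}" "\<pi> = foldr skew_sum \<alpha>s []"
      unfolding ominus12_eq by blast
    \<comment> \<open>Complement is an involution on the blocks, so complementing them yields a
      preimage of the given skew sum.\<close>
    define \<beta>s where "\<beta>s = map perm_complement \<alpha>s"
    have \<beta>s: "set \<beta>s \<subseteq> {[], [1], [2, 1]}"
      using \<alpha>s(1) compl by (auto simp: \<beta>s_def)
    have "map perm_complement \<beta>s = \<alpha>s"
      unfolding \<beta>s_def map_map using \<alpha>s(1) compl by (intro map_idI) auto
    then have "\<pi> = perm_complement (foldr direct_sum \<beta>s [])"
      using fold[of \<beta>s] perm \<beta>s unfolding \<alpha>s(2) by fastforce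
    with \<beta>s show "\<pi> \<in> perm_complement ` oplus21"
      unfolding oplus21_eq by blast
  qed
qed

text \<open>An increasing permutation is a direct sum of copies of 1. Through this inclusion the
  involution argument for \<open>oplus21\<close> also covers the monotone classes.\<close>

lemma Av_21_subset_oplus21: "Av [2, 1] \<subseteq> oplus21"
proof -
  have "foldr direct_sum (replicate n [1]) [] = [1..<Suc n]" for n
  proof (induction n)
    case (Suc n)
    have "direct_sum [1] [1..<Suc n] = 1 # map Suc [1..<Suc n]"
      by (simp add: direct_sum_def del: upt_Suc)
    also have "\<dots> = [1..<Suc (Suc n)]"
      unfolding map_Suc_upt by (rule upt_conv_Cons[symmetric]) simp
    finally have "direct_sum [1] [1..<Suc n] = [1..<Suc (Suc n)]" .
    with Suc show ?case
      by (simp del: upt_Suc)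
  qed simp
  moreover have "set (replicate n [1]) \<subseteq> {[], [1], [2, 1 :: nat]}" for n
    by auto
  ultimately have "[1..<Suc n] \<in> oplus21" for n
    unfolding oplus21_eq by (intro CollectI exI[of _ "replicate n [1]"]) (simp del: upt_Suc)
  then show ?thesis
    unfolding Av_21_eq by blast
qed

lemma perm_complement_Av_21: "perm_complement ` Av [2, 1] = Av [1, 2]"
proof -
  have "perm_complement [1..<Suc n] = rev [1..<Suc n]" for n
    by (rule nth_equalityI) (auto simp: perm_complement_nth rev_nth simp del: upt_Suc)
  then show ?thesis
    unfolding Av_12_eq Av_21_eq image_image by presburger
qed

text \<open>All members of \<open>oplus21\<close> are involutions; the inverses of members of \<open>B\<close> are found from this
  because complementing a permutation reverses its inverse.\<close>

lemma perm_symmetries: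
  assumes "A \<subseteq> oplus21" and "rev ` A = B" and "perm_complement ` A = B"
  shows "rev ` B = A" "perm_complement ` B = A" "perm_inverse ` A = A" "perm_inverse ` B = B"
proof -
  have perm: "is_perm \<pi>" "perm_inverse \<pi> = \<pi>" if "\<pi> \<in> A" for \<pi>
    using that assms(1) is_perm_in_oplus21 perm_inverse_in_oplus21 by blast+
  show "rev ` B = A"
    unfolding assms(2)[symmetric] by (simp add: image_image)
  show "perm_complement ` B = A"
    unfolding assms(3)[symmetric] image_image
    using perm perm_complement_perm_complement by (simp cong: image_cong)
  show inv: "perm_inverse ` A = A"
    using perm by (simp cong: image_cong)
  have "perm_inverse ` B = (\<lambda>\<pi>. rev (perm_inverse \<pi>)) ` A"
    unfolding assms(3)[symmetric] image_image
    using perm perm_inverse_perm_complement by (simp cong: image_cong)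
  also have "\<dots> = B"
    using inv assms(2) by (metis image_image)
  finally show "perm_inverse ` B = B" .
qed

text \<open>\<open>e\<close> marks an end of the path and \<open>s\<close> the increasing type, with
  \<open>oplus21\<close> counted as increasing. With this encoding every flip is a negation of
  \<open>s\<close> that leaves \<open>e\<close> alone.\<close>

definition cell_label :: "bool \<Rightarrow> bool \<Rightarrow> oneline set" where
  "cell_label e s = (if e then (if s then oplus21 else ominus12)
     else (if s then Av [2, 1] else Av [1, 2]))"

lemma cell_label_symmetries [simp]:
  "rev ` cell_label e s = cell_label e (\<not> s)"
  "perm_complement ` cell_label e s = cell_label e (\<not> s)"
  "perm_inverse ` cell_label e s = cell_label e s"
  using perm_symmetries[OF order_refl rev_oplus21 perm_complement_oplus21]
    perm_symmetries[OF Av_21_subset_oplus21 Av_12_eq[symmetric] perm_complement_Av_21]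
    rev_oplus21 perm_complement_oplus21 Av_12_eq[symmetric] perm_complement_Av_21
  unfolding cell_label_def by (cases e; cases s; presburger)+

section \<open>Matrices carrying a path\<close>

text \<open>Here cell \<open>a\<close> of the path lies in column \<open>c (Suc a div 2)\<close> and row \<open>r (a div 2)\<close>: the
  edges are alternately horizontal and vertical, and the first one is horizontal.\<close>

definition path_form :: "nat \<Rightarrow> (nat \<Rightarrow> nat) \<Rightarrow> (nat \<Rightarrow> nat) \<Rightarrow> (nat \<Rightarrow> bool) \<Rightarrow> gmatrix \<Rightarrow> bool" where
  "path_form k c r s M \<longleftrightarrow>
     bij_betw c {..Suc k div 2} {1..ncols M} \<and> bij_betw r {..k div 2} {1..nrows M} \<and>
     (\<forall>a\<le>k. entry M (c (Suc a div 2)) (r (a div 2)) = cell_label (a = 0 \<or> a = k) (s a)) \<and>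
     (\<forall>i j. entry M i j \<noteq> {} \<longrightarrow> (\<exists>a\<le>k. i = c (Suc a div 2) \<and> j = r (a div 2)))"

section \<open>Equivalence of two path forms of the same length\<close>

definition flip_columns :: "nat set \<Rightarrow> gmatrix \<Rightarrow> gmatrix" where
  "flip_columns X M = M\<lparr>entry := (\<lambda>i j. if i \<in> X then rev ` entry M i j else entry M i j)\<rparr>"

definition flip_rows :: "nat set \<Rightarrow> gmatrix \<Rightarrow> gmatrix" where
  "flip_rows Y M =
     M\<lparr>entry := (\<lambda>i j. if j \<in> Y then perm_complement ` entry M i j else entry M i j)\<rparr>"

text \<open>The identity is no constructor of \<open>grid_mapping\<close>; it arises as the trivial
  column permutation and serves as the flip of an empty set of lines.\<close>

lemma grid_mapping_id: "grid_mapping (m, n) (m, n) id"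
  using grid_mapping.column_permutation[OF permutes_id, of m n]
  by (simp add: column_permutation_def[abs_def] id_def)

lemma grid_mapping_flip_columns:
  assumes "X \<subseteq> {1..m}"
  shows "grid_mapping (m, n) (m, n) (flip_columns X)"
  using finite_subset[OF assms finite_atLeastAtMost] assms
proof (induction X)
  case empty
  have "flip_columns {} = id"
    by (auto simp: flip_columns_def)
  then show ?case
    using grid_mapping_id by metis
next
  case (insert c X)
  have "flip_columns (insert c X) = column_reverse c \<circ> flip_columns X"
    using insert.hyps by (auto simp: fun_eq_iff flip_columns_def column_reverse_def)
  then show ?case
    using insert by (metis grid_mapping.comp grid_mapping.column_reverse insert_subset)
qed

lemma grid_mapping_flip_rows:
  assumes "Y \<subseteq> {1..n}"
  shows "grid_mapping (m, n) (m, n) (flip_rows Y)"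
  using finite_subset[OF assms finite_atLeastAtMost] assms
proof (induction Y)
  case empty
  have "flip_rows {} = id"
    by (auto simp: flip_rows_def)
  then show ?case
    using grid_mapping_id by metis
next
  case (insert r Y)
  have "flip_rows (insert r Y) = row_complement r \<circ> flip_rows Y"
    using insert.hyps by (auto simp: fun_eq_iff flip_rows_def row_complement_def)
  then show ?case
    using insert by (metis grid_mapping.comp grid_mapping.row_complement insert_subset)
qed

text \<open>Two enumerations of the same lines differ by a permutation. It is the identity off
  \<open>B\<close>, as \<open>permutes\<close> demands.\<close>

lemma bij_betw_permutes:
  assumes "bij_betw f A B" and "bij_betw g A B"
  obtains \<mu> where "\<mu> permutes B" and "\<And>x. x \<in> A \<Longrightarrow> \<mu> (f x) = g x"
proof
  let ?\<mu> = "\<lambda>y. if y \<in> B then g (inv_into A f y) else y"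
  have "bij_betw (g \<circ> inv_into A f) B B"
    using assms bij_betw_inv_into bij_betw_trans by blast
  then have "bij_betw ?\<mu> B B"
    by (simp cong: bij_betw_cong add: comp_def)
  then show "?\<mu> permutes B"
    by (rule bij_imp_permutes) simp
  show "?\<mu> (f x) = g x" if "x \<in> A" for x
    using that assms(1) by (auto simp: bij_betw_def)
qed

lemma cell_label_nonempty [simp]: "cell_label e s \<noteq> {}"
proof -
  have ne: "Av [2, 1] \<noteq> {}" "oplus21 \<noteq> {}"
    using Av_21_subset_oplus21 unfolding Av_21_eq by blast+
  then show ?thesis
    using rev_oplus21 Av_12_eq unfolding cell_label_def by (metis image_is_empty)
qed

lemma path_form_dims:
  assumes "path_form k c r s M"
  shows "ncols M = Suc (Suc k div 2)" "nrows M = Suc (k div 2)"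
  using assms bij_betw_same_card[of c "{..Suc k div 2}"] bij_betw_same_card[of r "{..k div 2}"]
  by (auto simp: path_form_def)

text \<open>The rows and columns, listed as \<open>c 0, r 0, c 1, r 1, \<dots>\<close>, form a path whose edges are the
  cells, so flipping lines can realise every change of signs.\<close>

lemma path_form_equivalent:
  assumes M: "path_form k c r s M" and N: "path_form k c' r' s' N"
  shows "grid_equivalent M N"
proof -
  have dims: "ncols M = ncols N" "nrows M = nrows N"
    using path_form_dims[OF M] path_form_dims[OF N] by simp_all
  have bc: "bij_betw c {..Suc k div 2} {1..ncols N}" "bij_betw c' {..Suc k div 2} {1..ncols N}"
    and br: "bij_betw r {..k div 2} {1..nrows N}" "bij_betw r' {..k div 2} {1..nrows N}"
    using M N dims by (auto simp: path_form_def)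
  \<comment> \<open>The direction is from the lines of \<open>N\<close> to those of
    \<open>M\<close>, since a permuted matrix looks up its entry at \<open>\<mu> i\<close>.\<close>
  obtain \<mu> where \<mu>: "\<mu> permutes {1..ncols N}" "\<And>x. x \<le> Suc k div 2 \<Longrightarrow> \<mu> (c' x) = c x"
    using bij_betw_permutes[OF bc(2,1)] by (metis atMost_iff)
  obtain \<nu> where \<nu>: "\<nu> permutes {1..nrows N}" "\<And>x. x \<le> k div 2 \<Longrightarrow> \<nu> (r' x) = r x"
    using bij_betw_permutes[OF br(2,1)] by (metis atMost_iff)
  \<comment> \<open>\<open>t\<close> tells which lines to flip, with column \<open>c' m\<close>
    numbered \<open>2 * m\<close> and row \<open>r' m\<close> numbered \<open>Suc (2 * m)\<close>.
    The start value \<open>False\<close> is a free choice; afterwards \<open>t\<close> changes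
    exactly at the cells whose signs disagree.\<close>
  define t where "t = rec_nat False (\<lambda>a u. u \<noteq> (s a \<noteq> s' a))"
  have t: "t (Suc a) \<longleftrightarrow> (t a \<noteq> (s a \<noteq> s' a))" for a
    by (simp add: t_def)
  define X where "X = c' ` {m. m \<le> Suc k div 2 \<and> t (2 * m)}"
  define Y where "Y = r' ` {m. m \<le> k div 2 \<and> t (Suc (2 * m))}"
  have inj: "inj_on c' {..Suc k div 2}" "inj_on r' {..k div 2}"
    using bc br by (auto simp: bij_betw_def)
  have X: "c' m \<in> X \<longleftrightarrow> t (2 * m)" if "m \<le> Suc k div 2" for m
    using that inj(1) by (auto simp: X_def inj_on_def)
  have Y: "r' m \<in> Y \<longleftrightarrow> t (Suc (2 * m))" if "m \<le> k div 2" for m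
    using that inj(2) by (auto simp: Y_def inj_on_def)
  have XY: "(c' (Suc a div 2) \<in> X) \<noteq> (r' (a div 2) \<in> Y) \<longleftrightarrow> s a \<noteq> s' a" if "a \<le> k" for a
  proof -
    have le: "Suc a div 2 \<le> Suc k div 2" "a div 2 \<le> k div 2"
      using that by (simp_all add: div_le_mono)
    \<comment> \<open>The two lines through cell \<open>a\<close> have the numbers \<open>a\<close>
      and \<open>Suc a\<close>, the column coming first exactly for even \<open>a\<close>. Flipping
      both cancels, so only the change of \<open>t\<close> between them counts.\<close>
    have "{2 * (Suc a div 2), Suc (2 * (a div 2))} = {a, Suc a}"
      by (cases "even a") auto
    then have "t (2 * (Suc a div 2)) \<noteq> t (Suc (2 * (a div 2))) \<longleftrightarrow> t a \<noteq> t (Suc a)"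
      by (auto simp: doubleton_eq_iff)
    with t[of a] X[OF le(1)] Y[OF le(2)] show ?thesis
      by blast
  qed
  define f where
    "f = flip_rows Y \<circ> (flip_columns X \<circ> (row_permutation \<nu> \<circ> column_permutation \<mu>))"
  have "X \<subseteq> {1..ncols N}" "Y \<subseteq> {1..nrows N}"
    using bc(2) br(2) by (auto simp: X_def Y_def bij_betw_def)
  then have "grid_mapping (ncols M, nrows M) (ncols N, nrows N) f"
    unfolding f_def dims using \<mu>(1) \<nu>(1)
    by (intro grid_mapping.comp[where d' = "(ncols N, nrows N)"] grid_mapping_flip_rows
        grid_mapping_flip_columns grid_mapping.row_permutation grid_mapping.column_permutation)
  moreover have "f M = N"
  proof -
    have entry_f: "entry (f M) i j = (let E = entry M (\<mu> i) (\<nu> j);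
        E' = (if i \<in> X then rev ` E else E) in if j \<in> Y then perm_complement ` E' else E')" for i j
      by (simp add: f_def flip_rows_def flip_columns_def row_permutation_def
          column_permutation_def Let_def)
    have "entry (f M) i j = entry N i j" for i j
    proof (cases "\<exists>a\<le>k. i = c' (Suc a div 2) \<and> j = r' (a div 2)")
      case True
      then obtain a where a: "a \<le> k" "i = c' (Suc a div 2)" "j = r' (a div 2)"
        by blast
      then have "\<mu> i = c (Suc a div 2)" "\<nu> j = r (a div 2)"
        using \<mu>(2) \<nu>(2) by (simp_all add: div_le_mono)
      then have "entry M (\<mu> i) (\<nu> j) = cell_label (a = 0 \<or> a = k) (s a)"
        using M a(1) by (simp add: path_form_def)
      moreover have "entry N i j = cell_label (a = 0 \<or> a = k) (s' a)"
        using N a by (simp add: path_form_def)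
      ultimately show ?thesis
        using XY[OF a(1)] unfolding a(2,3)[symmetric]
        by (cases "s a"; cases "s' a") (simp_all add: entry_f Let_def)
    next
      case False
      have "entry M (\<mu> i) (\<nu> j) = {}"
      proof (rule ccontr)
        assume "entry M (\<mu> i) (\<nu> j) \<noteq> {}"
        then obtain a where a: "a \<le> k" "\<mu> i = c (Suc a div 2)" "\<nu> j = r (a div 2)"
          using M unfolding path_form_def by blast
        then have "\<mu> i = \<mu> (c' (Suc a div 2))" "\<nu> j = \<nu> (r' (a div 2))"
          using \<mu>(2) \<nu>(2) by (simp_all add: div_le_mono)
        then have "i = c' (Suc a div 2)" "j = r' (a div 2)"
          using permutes_inj[OF \<mu>(1)] permutes_inj[OF \<nu>(1)] by (auto dest: injD)
        with a(1) False show False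
          by blast
      qed
      moreover have "entry N i j = {}"
        using N False unfolding path_form_def by blast
      ultimately show ?thesis
        by (simp add: entry_f)
    qed
    moreover have "ncols (f M) = ncols N" "nrows (f M) = nrows N"
      by (simp_all add: f_def flip_rows_def flip_columns_def row_permutation_def
          column_permutation_def dims)
    ultimately show ?thesis
      by (intro gmatrix.equality ext) simp_all
  qed
  ultimately show ?thesis
    unfolding grid_equivalent_def by blast
qed

lemma path_form_grid_inverse_equivalent:
  assumes "path_form k c r s (grid_inverse M)" and "path_form k c' r' s' N"
  shows "grid_equivalent M N"
proof -
  obtain f where f: "grid_mapping (nrows M, ncols M) (ncols N, nrows N) f" "f (grid_inverse M) = N"
    using path_form_equivalent[OF assms] by (auto simp: grid_equivalent_def grid_inverse_def)
  then have "grid_mapping (ncols M, nrows M) (ncols N, nrows N) (f \<circ> grid_inverse)"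
    by (intro grid_mapping.comp[OF grid_mapping.inverse])
  with f(2) show ?thesis
    by (auto simp: grid_equivalent_def)
qed

section \<open>Coordinates along the path\<close>

text \<open>Consecutive cells share exactly one coordinate, being distinct, and cells two apart
  share none. So two successive edges cannot keep the same coordinate, and the direction of the
  first edge determines all others.\<close>

lemma alternating_path_coordinates:
  fixes ps :: "('a \<times> 'b) list"
  assumes len: "length ps = Suc k" and dist: "distinct ps"
    and line: "\<And>a b. a < b \<Longrightarrow> b \<le> k \<Longrightarrow>
      fst (ps ! a) = fst (ps ! b) \<or> snd (ps ! a) = snd (ps ! b) \<longleftrightarrow> b = Suc a"
    and first: "snd (ps ! 0) = snd (ps ! 1)"
  shows "\<exists>c r. bij_betw c {..Suc k div 2} (fst ` set ps) \<and>
    bij_betw r {..k div 2} (snd ` set ps) \<and>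
    (\<forall>a\<le>k. ps ! a = (c (Suc a div 2), r (a div 2)))"
proof -
  have exactly_one: "fst (ps ! a) = fst (ps ! Suc a) \<longleftrightarrow> snd (ps ! a) \<noteq> snd (ps ! Suc a)"
    if "a < k" for a
  proof -
    have "ps ! a \<noteq> ps ! Suc a"
      using that dist len by (simp add: nth_eq_iff_index_eq)
    with line[of a "Suc a"] that show ?thesis
      by (auto simp: prod_eq_iff)
  qed
  have snd_eq: "snd (ps ! a) = snd (ps ! Suc a) \<longleftrightarrow> even a" if "a < k" for a
    using that
  proof (induction a)
    case 0
    with first show ?case
      by simp
  next
    case (Suc a)
    have "\<not> (fst (ps ! a) = fst (ps ! Suc (Suc a)) \<or> snd (ps ! a) = snd (ps ! Suc (Suc a)))"
      using line[of a "Suc (Suc a)"] Suc.prems by simp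
    with Suc exactly_one[of a] exactly_one[of "Suc a"] show ?case
      by auto
  qed
  have fst_eq: "fst (ps ! a) = fst (ps ! Suc a) \<longleftrightarrow> odd a" if "a < k" for a
    using exactly_one snd_eq that by blast
  \<comment> \<open>Column \<open>m\<close> is read off at cell \<open>2 * m\<close> and row
    \<open>m\<close> at cell \<open>Suc (2 * m)\<close>. The cap at \<open>k\<close> concerns only
    the last line whose number exceeds \<open>k\<close>: it contains cell \<open>k\<close>
    alone.\<close>
  define c where "c m = fst (ps ! min (2 * m) k)" for m
  define r where "r m = snd (ps ! min (Suc (2 * m)) k)" for m
  have nth: "ps ! a = (c (Suc a div 2), r (a div 2))" if "a \<le> k" for a
  proof (cases "even a")
    case True
    then have "2 * (Suc a div 2) = a" "Suc (2 * (a div 2)) = Suc a"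
      by auto
    with True that show ?thesis
      using snd_eq[of a] by (cases "a = k") (auto simp: c_def r_def prod_eq_iff)
  next
    case False
    then have "2 * (Suc a div 2) = Suc a" "Suc (2 * (a div 2)) = a"
      by auto
    with False that show ?thesis
      using fst_eq[of a] by (cases "a = k") (auto simp: c_def r_def prod_eq_iff)
  qed
  have set: "set ps = (!) ps ` {..k}"
    using len by (auto simp: set_conv_nth image_iff less_Suc_eq_le)
  have "c m \<noteq> c m'" if "m < m'" "m' \<le> Suc k div 2" for m m'
  proof
    \<comment> \<open>A common column forces the two cells read off to be consecutive, but the edge
      leaving the even position \<open>2 * m\<close> is horizontal and changes the column.\<close>
    assume eq: "c m = c m'"
    have m: "2 * m < k" "2 * m < min (2 * m') k"
      using that by auto
    with eq have "min (2 * m') k = Suc (2 * m)"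
      using line[of "2 * m" "min (2 * m') k"] by (auto simp: c_def)
    with eq m fst_eq[of "2 * m"] show False
      by (simp add: c_def)
  qed
  then have "inj_on c {..Suc k div 2}"
    by (intro linorder_inj_onI) auto
  moreover have "c ` {..Suc k div 2} = fst ` set ps"
  proof
    show "c ` {..Suc k div 2} \<subseteq> fst ` set ps"
      using set by (auto simp: c_def)
    show "fst ` set ps \<subseteq> c ` {..Suc k div 2}"
      unfolding set using nth by (auto simp: div_le_mono)
  qed
  moreover have "r m \<noteq> r m'" if "m < m'" "m' \<le> k div 2" for m m'
  proof
    assume eq: "r m = r m'"
    have m: "Suc (2 * m) < k" "Suc (2 * m) < min (Suc (2 * m')) k"
      using that by auto
    with eq have "min (Suc (2 * m')) k = Suc (Suc (2 * m))"
      using line[of "Suc (2 * m)" "min (Suc (2 * m')) k"] by (auto simp: r_def)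
    with eq m snd_eq[of "Suc (2 * m)"] show False
      by (simp add: r_def)
  qed
  then have "inj_on r {..k div 2}"
    by (intro linorder_inj_onI) auto
  moreover have "r ` {..k div 2} = snd ` set ps"
  proof
    show "r ` {..k div 2} \<subseteq> snd ` set ps"
      using set by (auto simp: r_def)
    show "snd ` set ps \<subseteq> r ` {..k div 2}"
      unfolding set using nth by (auto simp: div_le_mono)
  qed
  ultimately show ?thesis
    unfolding bij_betw_def using nth by blast
qed

lemma eq_of_card_le_2:
  assumes "card A \<le> 2" "finite A" "x \<in> A" "y \<in> A" "z \<in> A" "x \<noteq> y" "x \<noteq> z"
  shows "y = z"
proof (rule ccontr)
  assume "y \<noteq> z"
  then have "card {x, y, z} = 3"
    using assms by simp
  moreover have "card {x, y, z} \<le> card A"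
    using assms by (intro card_mono) auto
  ultimately show False
    using assms(1) by simp
qed

text \<open>A line with at most two cells has no room for a cell blocking an adjacency.\<close>

lemma cell_adj_iff_common_line:
  assumes "at_most_two_per_line M" and "gridding_matrix M"
    and p: "p \<in> cells M" and q: "q \<in> cells M" and ne: "p \<noteq> q"
  shows "cell_adj M p q \<longleftrightarrow> fst p = fst q \<or> snd p = snd q"
proof
  show "cell_adj M p q \<Longrightarrow> fst p = fst q \<or> snd p = snd q"
    by (auto simp: cell_adj_def split: prod.splits)
next
  assume common: "fst p = fst q \<or> snd p = snd q"
  obtain i j i' j' where ij: "p = (i, j)" "q = (i', j')"
    by (metis surj_pair)
  have range: "a \<in> {1..ncols M}" "b \<in> {1..nrows M}" if "entry M a b \<noteq> {}" for a b
    using assms(2) that unfolding gridding_matrix_def by blast+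
  have cells: "entry M i j \<noteq> {}" "entry M i' j' \<noteq> {}"
    using p q ij by (auto simp: cells_def)
  show "cell_adj M p q"
  proof (cases "i = i'")
    case True
    have "entry M i b = {}" if "min j j' < b" "b < max j j'" for b
    proof (rule ccontr)
      assume b: "entry M i b \<noteq> {}"
      have "card {j \<in> {1..nrows M}. entry M i j \<noteq> {}} \<le> 2"
        using assms(1) range[OF b] by (auto simp: at_most_two_per_line_def)
      then have "j' = b"
        using True ne ij cells range b that
        by (intro eq_of_card_le_2[where x = j and A = "{j \<in> {1..nrows M}. entry M i j \<noteq> {}}"])
          auto
      with that show False
        by auto
    qed
    with True ij p q ne show ?thesis
      by (auto simp: cell_adj_def)
  next
    case False
    then have j: "j = j'"
      using common ij by simp
    have "entry M a j = {}" if "min i i' < a" "a < max i i'" for a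
    proof (rule ccontr)
      assume a: "entry M a j \<noteq> {}"
      have "card {i \<in> {1..ncols M}. entry M i j \<noteq> {}} \<le> 2"
        using assms(1) range[OF a] by (auto simp: at_most_two_per_line_def)
      then have "i' = a"
        using j ne ij cells range a that
        by (intro eq_of_card_le_2[where x = i and A = "{i \<in> {1..ncols M}. entry M i j \<noteq> {}}"])
          auto
      with that show False
        by auto
    qed
    with j ij p q ne show ?thesis
      by (auto simp: cell_adj_def)
  qed
qed

lemma path_form_of_listing:
  assumes grid: "gridding_matrix M" and lines: "no_empty_line M"
    and two: "at_most_two_per_line M"
    and path: "path_graph_listing (cells M) (cell_adj M) k vs"
    and label: "\<And>a. a \<le> k \<Longrightarrow>
      entry M (fst (vs ! a)) (snd (vs ! a)) = cell_label (a = 0 \<or> a = k) (s a)"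
    and "k \<ge> 1"
  shows "\<exists>c r. path_form k c r s M \<or> path_form k c r s (grid_inverse M)"
proof -
  have vs: "length vs = Suc k" "distinct vs" "set vs = cells M"
    and adj: "\<And>a b. a \<le> k \<Longrightarrow> b \<le> k \<Longrightarrow> cell_adj M (vs ! a) (vs ! b) \<longleftrightarrow> b = Suc a \<or> a = Suc b"
    using path by (auto simp: path_graph_listing_def)
  have mem: "vs ! a \<in> cells M" if "a \<le> k" for a
    using that vs nth_mem[of a vs] by simp
  have line: "fst (vs ! a) = fst (vs ! b) \<or> snd (vs ! a) = snd (vs ! b) \<longleftrightarrow> b = Suc a"
    if "a < b" "b \<le> k" for a b
  proof -
    have "vs ! a \<noteq> vs ! b"
      using that vs by (simp add: nth_eq_iff_index_eq)
    with that adj[of a b] cell_adj_iff_common_line[OF two grid mem mem, of a b] show ?thesis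
      by auto
  qed
  \<comment> \<open>As no line is empty, the path meets every line, so an enumeration of the lines
    met is one of all lines.\<close>
  have cells: "fst ` cells M = {1..ncols M}" "snd ` cells M = {1..nrows M}"
  proof -
    have "i \<in> fst ` cells M" if i: "i \<in> {1..ncols M}" for i
    proof -
      obtain j where "j \<in> {1..nrows M}" "entry M i j \<noteq> {}"
        using lines i unfolding no_empty_line_def by blast
      with i have "(i, j) \<in> cells M"
        by (simp add: cells_def)
      then show ?thesis
        by force
    qed
    moreover have "j \<in> snd ` cells M" if j: "j \<in> {1..nrows M}" for j
    proof -
      obtain i where "i \<in> {1..ncols M}" "entry M i j \<noteq> {}"
        using lines j unfolding no_empty_line_def by blast
      with j have "(i, j) \<in> cells M"
        by (simp add: cells_def)
      then show ?thesis
        by force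
    qed
    ultimately show "fst ` cells M = {1..ncols M}" "snd ` cells M = {1..nrows M}"
      by (auto simp: cells_def)
  qed
  have nonempty: "(i, j) \<in> cells M" if "entry M i j \<noteq> {}" for i j
    using grid that unfolding gridding_matrix_def cells_def by blast
  have index: "\<exists>a\<le>k. vs ! a = (i, j)" if "entry M i j \<noteq> {}" for i j
    using nonempty[OF that] unfolding vs(3)[symmetric] in_set_conv_nth vs(1) less_Suc_eq_le by blast
  consider "snd (vs ! 0) = snd (vs ! 1)" | "fst (vs ! 0) = fst (vs ! 1)"
    using line[of 0 1] \<open>k \<ge> 1\<close> by auto
  then show ?thesis
  proof cases
    case 1
    have "\<exists>c r. bij_betw c {..Suc k div 2} (fst ` set vs) \<and>
        bij_betw r {..k div 2} (snd ` set vs) \<and>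
        (\<forall>a\<le>k. vs ! a = (c (Suc a div 2), r (a div 2)))"
      by (rule alternating_path_coordinates[OF vs(1,2) _ 1]) (rule line)
    then obtain c r where cr: "bij_betw c {..Suc k div 2} {1..ncols M}"
      "bij_betw r {..k div 2} {1..nrows M}"
      "\<And>a. a \<le> k \<Longrightarrow> vs ! a = (c (Suc a div 2), r (a div 2))"
      unfolding vs(3) cells by blast
    have "path_form k c r s M"
      unfolding path_form_def
    proof (intro conjI allI impI)
      show "entry M (c (Suc a div 2)) (r (a div 2)) = cell_label (a = 0 \<or> a = k) (s a)"
        if "a \<le> k" for a
        using label[OF that] cr(3)[OF that] by simp
      show "\<exists>a\<le>k. i = c (Suc a div 2) \<and> j = r (a div 2)" if "entry M i j \<noteq> {}" for i j
        using index[OF that] cr(3) by auto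
    qed (use cr in simp_all)
    then show ?thesis
      by blast
  next
    case 2
    \<comment> \<open>Swapping coordinates makes the first edge horizontal. The swapped list runs
      through the cells of \<open>grid_inverse M\<close>, whose labels are unchanged because the
      label classes are closed under inverses.\<close>
    let ?ws = "map prod.swap vs"
    have ws: "length ?ws = Suc k" "distinct ?ws" "snd (?ws ! 0) = snd (?ws ! 1)"
      using vs 2 \<open>k \<ge> 1\<close> by (simp_all add: distinct_map)
    have line_ws: "fst (?ws ! a) = fst (?ws ! b) \<or> snd (?ws ! a) = snd (?ws ! b) \<longleftrightarrow> b = Suc a"
      if "a < b" "b \<le> k" for a b
      using line[OF that] that vs by auto
    have "\<exists>c r. bij_betw c {..Suc k div 2} (fst ` set ?ws) \<and>
        bij_betw r {..k div 2} (snd ` set ?ws) \<and>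
        (\<forall>a\<le>k. ?ws ! a = (c (Suc a div 2), r (a div 2)))"
      by (rule alternating_path_coordinates[OF ws(1,2) _ ws(3)]) (rule line_ws)
    moreover have "fst ` set ?ws = {1..nrows M}" "snd ` set ?ws = {1..ncols M}"
      using cells by (simp_all add: vs(3) image_image)
    ultimately obtain c r where cr: "bij_betw c {..Suc k div 2} {1..nrows M}"
      "bij_betw r {..k div 2} {1..ncols M}"
      "\<And>a. a \<le> k \<Longrightarrow> ?ws ! a = (c (Suc a div 2), r (a div 2))"
      by metis
    have nth: "vs ! a = (r (a div 2), c (Suc a div 2))" if "a \<le> k" for a
      using cr(3)[OF that] that vs by (simp add: prod_eq_iff)
    have "path_form k c r s (grid_inverse M)"
      unfolding path_form_def
    proof (intro conjI allI impI)
      show "entry (grid_inverse M) (c (Suc a div 2)) (r (a div 2))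
          = cell_label (a = 0 \<or> a = k) (s a)" if "a \<le> k" for a
        using label[OF that] nth[OF that] by (simp add: grid_inverse_def)
      show "\<exists>a\<le>k. i = c (Suc a div 2) \<and> j = r (a div 2)"
        if "entry (grid_inverse M) i j \<noteq> {}" for i j
        using index[of j i] that nth by (auto simp: grid_inverse_def)
    qed (use cr in \<open>simp_all add: grid_inverse_def\<close>)
    then show ?thesis
      by blast
  qed
qed

section \<open>The matrices \<open>path_matrix k\<close>\<close>

text \<open>This settles the range guards in the recursion for \<open>path_matrix\<close>: outside
  the old matrix there is nothing to copy.\<close>

lemma path_form_entry_outside:
  assumes "path_form k c r s M" and "i \<notin> {1..ncols M} \<or> j \<notin> {1..nrows M}"
  shows "entry M i j = {}"
proof (rule ccontr)
  assume "entry M i j \<noteq> {}"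
  then obtain a where "a \<le> k" "i = c (Suc a div 2)" "j = r (a div 2)"
    using assms(1) unfolding path_form_def by blast
  moreover from \<open>a \<le> k\<close> have "c (Suc a div 2) \<in> {1..ncols M}" "r (a div 2) \<in> {1..nrows M}"
    using assms(1) bij_betw_apply[of c "{..Suc k div 2}"] bij_betw_apply[of r "{..k div 2}"]
    unfolding path_form_def by (simp_all only: atMost_iff div_le_mono Suc_le_mono)
  ultimately show False
    using assms(2) by simp
qed

lemma bij_betw_extend:
  fixes c :: "nat \<Rightarrow> 'a"
  assumes "bij_betw c {..h} A" and "inj_on f A" and "q \<notin> f ` A"
  shows "bij_betw (\<lambda>m. if m \<le> h then f (c m) else q) {..Suc h} (insert q (f ` A))"
proof -
  have "bij_betw (f \<circ> c) {..h} (f ` A)"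
    by (rule bij_betw_trans[OF assms(1) bij_betw_imageI[OF assms(2) refl]])
  moreover have "bij_betw (f \<circ> c) {..h} (f ` A) \<longleftrightarrow>
      bij_betw (\<lambda>m. if m \<le> h then f (c m) else q) {..h} (f ` A)"
    by (rule bij_betw_cong) simp
  ultimately have "bij_betw (\<lambda>m. if m \<le> h then f (c m) else q) {..h} (f ` A)"
    by blast
  from notIn_Un_bij_betw[OF _ _ this, of "Suc h"] assms(3) show ?thesis
    by (simp add: atMost_Suc)
qed

text \<open>For even \<open>k\<close> the end cell is alone in the last row of the path, so
  rewriting that row disturbs no other cell. \<open>f\<close> renumbers the old columns and
  \<open>q\<close> is the new one. Since \<open>k \<ge> 1\<close>, the cell that becomes monotone is
  not also the start of the path.\<close>

lemma path_form_add_column: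
  assumes M: "path_form k c r s M" and k: "even k" "k \<ge> 1"
    and f: "inj f" "{1..ncols N} = insert q (f ` {1..ncols M})" "q \<notin> f ` {1..ncols M}"
    and rows: "nrows N = nrows M"
    and old: "\<And>i j. i \<in> {1..ncols M} \<Longrightarrow> j \<noteq> r (k div 2) \<Longrightarrow> entry N (f i) j = entry M i j"
    and turn: "entry N (f (c (k div 2))) (r (k div 2)) = cell_label False (s k)"
    and new: "entry N q (r (k div 2)) = cell_label True (s (Suc k))"
    and rest: "\<And>i j. entry N i j \<noteq> {} \<Longrightarrow> (i \<in> f ` {1..ncols M} \<and> j \<noteq> r (k div 2)) \<or>
      (j = r (k div 2) \<and> (i = q \<or> i = f (c (k div 2))))"
  shows "path_form (Suc k) (\<lambda>m. if m \<le> k div 2 then f (c m) else q) r s N"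
proof -
  define h where "h = k div 2"
  have k_eq: "k = 2 * h"
    using k by (simp add: h_def)
  have bij: "bij_betw c {..h} {1..ncols M}" "bij_betw r {..h} {1..nrows M}"
    and entry: "\<And>a. a \<le> k \<Longrightarrow>
      entry M (c (Suc a div 2)) (r (a div 2)) = cell_label (a = 0 \<or> a = k) (s a)"
    and supp: "\<And>i j. entry M i j \<noteq> {} \<Longrightarrow> \<exists>a\<le>k. i = c (Suc a div 2) \<and> j = r (a div 2)"
    using M unfolding path_form_def k_eq by auto
  show ?thesis
    unfolding path_form_def h_def[symmetric]
  proof (intro conjI allI impI)
    show "bij_betw (\<lambda>m. if m \<le> h then f (c m) else q) {..Suc (Suc k) div 2} {1..ncols N}"
      using bij_betw_extend[OF bij(1) _ f(3)] f(1,2) by (simp add: k_eq inj_on_subset)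
    show "bij_betw r {..Suc k div 2} {1..nrows N}"
      using bij(2) by (simp add: rows k_eq)
  next
    fix a assume "a \<le> Suc k"
    then consider "a < k" | "a = k" | "a = Suc k"
      by linarith
    then show "entry N (if Suc a div 2 \<le> h then f (c (Suc a div 2)) else q) (r (a div 2))
        = cell_label (a = 0 \<or> a = Suc k) (s a)"
    proof cases
      case 1
      then have a: "Suc a div 2 \<le> h" "a div 2 < h"
        by (auto simp: k_eq)
      then have "r (a div 2) \<noteq> r h"
        using bij_betw_imp_inj_on[OF bij(2)] by (auto dest: inj_onD)
      moreover have "c (Suc a div 2) \<in> {1..ncols M}"
        using a bij_betw_apply[OF bij(1)] by blast
      ultimately show ?thesis
        using 1 a entry[of a] old by (simp add: h_def)
    next
      case 2
      then show ?thesis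
        using turn k by (simp add: h_def)
    next
      case 3
      then show ?thesis
        using new by (simp add: k_eq)
    qed
  next
    fix i j assume ne: "entry N i j \<noteq> {}"
    from rest[OF this] consider i' where "i = f i'" "i' \<in> {1..ncols M}" "j \<noteq> r h"
      | "j = r h" "i = q" | "j = r h" "i = f (c h)"
      by (auto simp: h_def)
    then show "\<exists>a\<le>Suc k. i = (if Suc a div 2 \<le> h then f (c (Suc a div 2)) else q) \<and> j = r (a div 2)"
    proof cases
      case 1
      with ne old have "entry M i' j \<noteq> {}"
        by (simp add: h_def)
      from supp[OF this] obtain a where "a \<le> k" "i' = c (Suc a div 2)" "j = r (a div 2)"
        by blast
      with 1 show ?thesis
        by (intro exI[of _ a]) (auto simp: k_eq)
    next
      case 2
      then show ?thesis
        by (intro exI[of _ "Suc k"]) (simp add: k_eq)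
    next
      case 3
      then show ?thesis
        by (intro exI[of _ k]) (simp add: k_eq)
    qed
  qed
qed

text \<open>The mirror case: for odd \<open>k\<close> the end cell is alone in the last column of
  the path, and that column is rewritten.\<close>

lemma path_form_add_row:
  assumes M: "path_form k c r s M" and k: "odd k"
    and f: "inj f" "{1..nrows N} = insert q (f ` {1..nrows M})" "q \<notin> f ` {1..nrows M}"
    and cols: "ncols N = ncols M"
    and old: "\<And>i j. j \<in> {1..nrows M} \<Longrightarrow> i \<noteq> c (Suc k div 2) \<Longrightarrow> entry N i (f j) = entry M i j"
    and turn: "entry N (c (Suc k div 2)) (f (r (k div 2))) = cell_label False (s k)"
    and new: "entry N (c (Suc k div 2)) q = cell_label True (s (Suc k))"
    and rest: "\<And>i j. entry N i j \<noteq> {} \<Longrightarrow> (j \<in> f ` {1..nrows M} \<and> i \<noteq> c (Suc k div 2)) \<or>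
      (i = c (Suc k div 2) \<and> (j = q \<or> j = f (r (k div 2))))"
  shows "path_form (Suc k) c (\<lambda>m. if m \<le> k div 2 then f (r m) else q) s N"
proof -
  define h where "h = k div 2"
  have k_eq: "k = Suc (2 * h)"
    using k by (simp add: h_def)
  have bij: "bij_betw c {..Suc h} {1..ncols M}" "bij_betw r {..h} {1..nrows M}"
    and entry: "\<And>a. a \<le> k \<Longrightarrow>
      entry M (c (Suc a div 2)) (r (a div 2)) = cell_label (a = 0 \<or> a = k) (s a)"
    and supp: "\<And>i j. entry M i j \<noteq> {} \<Longrightarrow> \<exists>a\<le>k. i = c (Suc a div 2) \<and> j = r (a div 2)"
    using M unfolding path_form_def k_eq by auto
  have last: "c (Suc k div 2) = c (Suc h)"
    by (simp add: k_eq)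
  show ?thesis
    unfolding path_form_def h_def[symmetric]
  proof (intro conjI allI impI)
    show "bij_betw c {..Suc (Suc k) div 2} {1..ncols N}"
      using bij(1) by (simp add: cols k_eq)
    show "bij_betw (\<lambda>m. if m \<le> h then f (r m) else q) {..Suc k div 2} {1..nrows N}"
      using bij_betw_extend[OF bij(2) _ f(3)] f(1,2) by (simp add: k_eq inj_on_subset)
  next
    fix a assume "a \<le> Suc k"
    then consider "a < k" | "a = k" | "a = Suc k"
      by linarith
    then show "entry N (c (Suc a div 2)) (if a div 2 \<le> h then f (r (a div 2)) else q)
        = cell_label (a = 0 \<or> a = Suc k) (s a)"
    proof cases
      case 1
      then have a: "Suc a div 2 < Suc h" "a div 2 \<le> h"
        by (auto simp: k_eq)
      then have "c (Suc a div 2) \<noteq> c (Suc h)"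
        using bij_betw_imp_inj_on[OF bij(1)] by (auto dest: inj_onD)
      moreover have "r (a div 2) \<in> {1..nrows M}"
        using a bij_betw_apply[OF bij(2)] by blast
      ultimately show ?thesis
        using 1 a entry[of a] old unfolding last by simp
    next
      case 2
      then show ?thesis
        using turn odd_pos[OF k] by (simp add: h_def)
    next
      case 3
      then show ?thesis
        using new by (simp add: k_eq)
    qed
  next
    fix i j assume ne: "entry N i j \<noteq> {}"
    from rest[OF this] consider j' where "j = f j'" "j' \<in> {1..nrows M}" "i \<noteq> c (Suc h)"
      | "i = c (Suc h)" "j = q" | "i = c (Suc h)" "j = f (r h)"
      unfolding last h_def[symmetric] by auto
    then show "\<exists>a\<le>Suc k. i = c (Suc a div 2) \<and> j = (if a div 2 \<le> h then f (r (a div 2)) else q)"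
    proof cases
      case 1
      with ne old have "entry M i j' \<noteq> {}"
        unfolding last by simp
      from supp[OF this] obtain a where "a \<le> k" "i = c (Suc a div 2)" "j' = r (a div 2)"
        by blast
      with 1 show ?thesis
        by (intro exI[of _ a]) (auto simp: k_eq)
    next
      case 2
      then show ?thesis
        by (intro exI[of _ "Suc k"]) (simp add: k_eq)
    next
      case 3
      then show ?thesis
        by (intro exI[of _ k]) (simp add: k_eq)
    qed
  qed
qed

text \<open>The two extra equations say in which corner the path ends: bottom right, top right, top
  left, bottom left for \<open>k mod 4\<close> equal to 1, 2, 3, 0. The recursion rewrites a fixed
  boundary line, and these equations identify it as the line of the end cell.\<close>

lemma path_form_path_matrix:
  assumes "k \<ge> 1"
  shows "\<exists>c r. path_form k c r even (path_matrix k) \<and>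
    c (Suc k div 2) = (if k mod 4 \<in> {1, 2} then Suc (Suc k div 2) else 1) \<and>
    r (k div 2) = (if k mod 4 \<in> {2, 3} then Suc (k div 2) else 1)"
  using assms
proof (induction k rule: dec_induct)
  case base
  have bij: "bij_betw Suc {..n} {1..Suc n}" for n
    by (simp add: bij_betw_def image_Suc_atMost)
  have N: "path_matrix 1 = \<lparr>ncols = 2, nrows = 1, entry = (\<lambda>i j.
      if (i, j) = (1, 1) then oplus21 else if (i, j) = (2, 1) then ominus12 else {})\<rparr>"
    by simp
  have "path_form 1 Suc Suc even (path_matrix 1)"
    unfolding path_form_def N using bij[of 0] bij[of 1]
    by (auto simp: le_Suc_eq cell_label_def numeral_2_eq_2 split: if_splits)
  then show ?case
    by (intro exI[of _ Suc]) simp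
next
  case (step k)
  define l where "l = k div 4"
  have k_cases: "k = 4 * l \<or> k = 4 * l + 1 \<or> k = 4 * l + 2 \<or> k = 4 * l + 3"
    unfolding l_def by presburger
  from step.IH obtain c r where M: "path_form k c r even (path_matrix k)"
    and c: "c (Suc k div 2) = (if k mod 4 \<in> {1, 2} then Suc (Suc k div 2) else 1)"
    and r: "r (k div 2) = (if k mod 4 \<in> {2, 3} then Suc (k div 2) else 1)"
    by blast
  note dims = path_form_dims[OF M]
  note outside = path_form_entry_outside[OF M]
  from k_cases consider "k = 4 * l" | "k = 4 * l + 1" | "k = 4 * l + 2" | "k = 4 * l + 3"
    by blast
  then show ?case
  proof cases
    case 1
    then have nums: "Suc k div 2 = 2 * l" "k div 2 = 2 * l" "k mod 4 = 0" "k div 4 = l" "k \<ge> 1"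
        "Suc (Suc k) div 2 = Suc (2 * l)" "Suc k mod 4 = 1" and parity: "even k"
      using step.hyps by presburger+
    have cr: "c (2 * l) = 1" "r (2 * l) = 1"
      using c r unfolding nums by simp_all
    have N: "path_matrix (Suc k) = \<lparr>ncols = 2 * l + 2, nrows = 2 * l + 1, entry = (\<lambda>i j.
        if i \<in> {1..2 * l + 1} \<and> j \<in> {2..2 * l + 1} then entry (path_matrix k) i j
        else if (i, j) = (2 * l + 2, 1) then ominus12
        else if (i, j) = (1, 1) then Av [2, 1]
        else {})\<rparr>"
      using nums by (simp add: Let_def)
    \<comment> \<open>From the bottom left corner the path runs along the bottom row to a new
      rightmost column; old columns keep their numbers.\<close>
    have "path_form (Suc k) (\<lambda>m. if m \<le> k div 2 then id (c m) else (2 * l + 2)) r even (path_matrix (Suc k))"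
    proof (rule path_form_add_column[OF M])
      show "entry (path_matrix (Suc k)) (id i) j = entry (path_matrix k) i j"
        if "i \<in> {1..ncols (path_matrix k)}" "j \<noteq> r (k div 2)" for i j
        using that outside[of i j] unfolding N nums cr dims by auto
      show "(i \<in> id ` {1..ncols (path_matrix k)} \<and> j \<noteq> r (k div 2)) \<or>
          (j = r (k div 2) \<and> (i = (2 * l + 2) \<or> i = id (c (k div 2))))"
        if "entry (path_matrix (Suc k)) i j \<noteq> {}" for i j
        using that outside[of i j] unfolding N nums cr dims
        by (auto simp: image_Suc_atLeastAtMost split: if_splits)
    qed (use parity nums in \<open>auto simp: N nums cr dims cell_label_def image_Suc_atLeastAtMost
        simp del: path_matrix.simps\<close>)
    then show ?thesis
      by (intro exI conjI) (assumption, simp_all add: nums cr)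
  next
    case 2
    then have nums: "Suc k div 2 = Suc (2 * l)" "k div 2 = 2 * l" "k mod 4 = 1" "k div 4 = l" "k \<ge> 1"
        "Suc (Suc k) div 2 = Suc (2 * l)" "Suc k mod 4 = 2" and parity: "odd k"
      using step.hyps by presburger+
    have cr: "c (Suc (2 * l)) = 2 * l + 2" "r (2 * l) = 1"
      using c r unfolding nums by simp_all
    have N: "path_matrix (Suc k) = \<lparr>ncols = 2 * l + 2, nrows = 2 * l + 2, entry = (\<lambda>i j.
        if i \<in> {1..2 * l + 1} \<and> j \<in> {1..2 * l + 1} then entry (path_matrix k) i j
        else if (i, j) = (2 * l + 2, 2 * l + 2) then oplus21
        else if (i, j) = (2 * l + 2, 1) then Av [1, 2]
        else {})\<rparr>"
      using nums by (simp add: Let_def)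
    \<comment> \<open>It then climbs the rightmost column to a new top row, again without
      renumbering.\<close>
    have "path_form (Suc k) c (\<lambda>m. if m \<le> k div 2 then id (r m) else (2 * l + 2)) even (path_matrix (Suc k))"
    proof (rule path_form_add_row[OF M])
      show "entry (path_matrix (Suc k)) i (id j) = entry (path_matrix k) i j"
        if "j \<in> {1..nrows (path_matrix k)}" "i \<noteq> c (Suc k div 2)" for i j
        using that outside[of i j] unfolding N nums cr dims by auto
      show "(j \<in> id ` {1..nrows (path_matrix k)} \<and> i \<noteq> c (Suc k div 2)) \<or>
          (i = c (Suc k div 2) \<and> (j = (2 * l + 2) \<or> j = id (r (k div 2))))"
        if "entry (path_matrix (Suc k)) i j \<noteq> {}" for i j
        using that outside[of i j] unfolding N nums cr dims
        by (auto simp: image_Suc_atLeastAtMost split: if_splits)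
    qed (use parity nums in \<open>auto simp: N nums cr dims cell_label_def image_Suc_atLeastAtMost
        simp del: path_matrix.simps\<close>)
    then show ?thesis
      by (intro exI conjI) (assumption, simp_all add: nums cr)
  next
    case 3
    then have nums: "Suc k div 2 = Suc (2 * l)" "k div 2 = Suc (2 * l)" "k mod 4 = 2" "k div 4 = l" "k \<ge> 1"
        "Suc (Suc k) div 2 = Suc (Suc (2 * l))" "Suc k mod 4 = 3" and parity: "even k"
      using step.hyps by presburger+
    have cr: "c (Suc (2 * l)) = 2 * l + 2" "r (Suc (2 * l)) = 2 * l + 2"
      using c r unfolding nums by simp_all
    have N: "path_matrix (Suc k) = \<lparr>ncols = 2 * l + 3, nrows = 2 * l + 2, entry = (\<lambda>i j.
        if i \<in> {2..2 * l + 3} \<and> j \<in> {1..2 * l + 1} then entry (path_matrix k) (i - 1) j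
        else if (i, j) = (1, 2 * l + 2) then ominus12
        else if (i, j) = (2 * l + 3, 2 * l + 2) then Av [2, 1]
        else {})\<rparr>"
      using nums by (simp add: Let_def)
    \<comment> \<open>The new column is inserted at the left, so the old columns shift by
      one.\<close>
    have "path_form (Suc k) (\<lambda>m. if m \<le> k div 2 then Suc (c m) else 1) r even (path_matrix (Suc k))"
    proof (rule path_form_add_column[OF M])
      show "entry (path_matrix (Suc k)) (Suc i) j = entry (path_matrix k) i j"
        if "i \<in> {1..ncols (path_matrix k)}" "j \<noteq> r (k div 2)" for i j
        using that outside[of i j] unfolding N nums cr dims by auto
      show "(i \<in> Suc ` {1..ncols (path_matrix k)} \<and> j \<noteq> r (k div 2)) \<or>
          (j = r (k div 2) \<and> (i = 1 \<or> i = Suc (c (k div 2))))"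
        if "entry (path_matrix (Suc k)) i j \<noteq> {}" for i j
        using that outside[of i j] unfolding N nums cr dims
        by (auto simp: image_Suc_atLeastAtMost split: if_splits)
    qed (use parity nums in \<open>auto simp: N nums cr dims cell_label_def image_Suc_atLeastAtMost
        simp del: path_matrix.simps\<close>)
    then show ?thesis
      by (intro exI conjI) (assumption, simp_all add: nums cr)
  next
    case 4
    then have nums: "Suc k div 2 = Suc (Suc (2 * l))" "k div 2 = Suc (2 * l)" "k mod 4 = 3" "k div 4 = l" "k \<ge> 1"
        "Suc (Suc k) div 2 = Suc (Suc (2 * l))" "Suc k mod 4 = 0" and parity: "odd k"
      using step.hyps by presburger+
    have cr: "c (Suc (Suc (2 * l))) = 1" "r (Suc (2 * l)) = 2 * l + 2"
      using c r unfolding nums by simp_all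
    have N: "path_matrix (Suc k) = \<lparr>ncols = 2 * l + 3, nrows = 2 * l + 3, entry = (\<lambda>i j.
        if i \<in> {2..2 * l + 3} \<and> j \<in> {2..2 * l + 3} then entry (path_matrix k) i (j - 1)
        else if (i, j) = (1, 1) then oplus21
        else if (i, j) = (1, 2 * l + 3) then Av [1, 2]
        else {})\<rparr>"
      using nums by (simp add: Let_def)
    \<comment> \<open>The new row is inserted at the bottom, so the old rows shift by one.\<close>
    have "path_form (Suc k) c (\<lambda>m. if m \<le> k div 2 then Suc (r m) else 1) even (path_matrix (Suc k))"
    proof (rule path_form_add_row[OF M])
      show "entry (path_matrix (Suc k)) i (Suc j) = entry (path_matrix k) i j"
        if "j \<in> {1..nrows (path_matrix k)}" "i \<noteq> c (Suc k div 2)" for i j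
        using that outside[of i j] unfolding N nums cr dims by auto
      show "(j \<in> Suc ` {1..nrows (path_matrix k)} \<and> i \<noteq> c (Suc k div 2)) \<or>
          (i = c (Suc k div 2) \<and> (j = 1 \<or> j = Suc (r (k div 2))))"
        if "entry (path_matrix (Suc k)) i j \<noteq> {}" for i j
        using that outside[of i j] unfolding N nums cr dims
        by (auto simp: image_Suc_atLeastAtMost split: if_splits)
    qed (use parity nums in \<open>auto simp: N nums cr dims cell_label_def image_Suc_atLeastAtMost
        simp del: path_matrix.simps\<close>)
    then show ?thesis
      by (intro exI conjI) (assumption, simp_all add: nums cr)
  qed
qed

theorem theorem15:
  fixes k :: nat and M :: gmatrix and vs :: "(nat \<times> nat) list"
  assumes "k \<ge> 1"
    and "gridding_matrix M"
    and "no_empty_line M"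
    and "at_most_two_per_line M"
    and "path_graph_listing (cells M) (cell_adj M) k vs"
    and "\<And>a i j. 0 < a \<Longrightarrow> a < k \<Longrightarrow> vs ! a = (i, j) \<Longrightarrow>
           entry M i j = Av [2, 1] \<or> entry M i j = Av [1, 2]"
    and "\<And>a i j. a = 0 \<or> a = k \<Longrightarrow> vs ! a = (i, j) \<Longrightarrow>
           entry M i j = oplus21 \<or> entry M i j = ominus12"
  shows "grid_equivalent M (path_matrix k)"
proof -
  define e where "e a \<longleftrightarrow> a = 0 \<or> a = k" for a
  \<comment> \<open>The sign is obtained by testing for the increasing label; where the test fails,
    the hypotheses leave only the decreasing one.\<close>
  define s where "s a \<longleftrightarrow> entry M (fst (vs ! a)) (snd (vs ! a)) = cell_label (e a) True" for a
  have "entry M (fst (vs ! a)) (snd (vs ! a)) = cell_label (e a) (s a)" if "a \<le> k" for a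
    using that assms(6)[of a "fst (vs ! a)" "snd (vs ! a)"]
      assms(7)[of a "fst (vs ! a)" "snd (vs ! a)"]
    by (cases "e a") (auto simp: s_def e_def cell_label_def)
  then obtain c r where "path_form k c r s M \<or> path_form k c r s (grid_inverse M)"
    using path_form_of_listing[OF assms(2-5) _ assms(1), of s] unfolding e_def by blast
  moreover obtain c' r' where "path_form k c' r' even (path_matrix k)"
    using path_form_path_matrix[OF assms(1)] by blast
  ultimately show ?thesis
    using path_form_equivalent path_form_grid_inverse_equivalent by blast
qed

end
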